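(* Let $\Gamma=(\mathcal{C},\mathcal{G},\Omega)$ be a width category and let $f:X\hookrightarrow Y$ be a monomorphism in $\mathcal{C}$. Then $\mathbf{w}_\Gamma(X)\le \mathbf{w}_\Gamma(Y)$.
   Context: Graphs: a graph $G$ is a finite vertex set $V(G)$ with a symmetric irreflexive relation $E(G)\subseteq V(G)^2$; $\bullet$ is the one-vertex graph. The category $\int G$ has as objects the vertices of $G$ and the (unordered) edges of $G$; its only non-identity morphisms are, for each edge $e=xy$, two morphisms $e_x:e\to x$ and $e_y:e\to y$. (Index graphs may also be multigraphs, in which case $\int G$ has one span $x\leftarrow e\to y$ for each edge $e$, with two distinct legs even if $e$ is a loop.) Structured decompositions: a structured decomposition of shape $G$ in a category $\mathcal{C}$ is a functor $d:\int G\to\mathcal{C}$ sending every morphism to a monomorphism; the objects $d(v)$, $v\in V(G)$, are its bags. It is a structured decomposition of an object $X$ if $X\cong\operatorname{colim} d$. For a set $\mathcal{G}$ of graphs, a $\mathcal{G}$-structured decomposition is one whose shape is in $\mathcal{G}$. sd-category: a pair $(\mathcal{C},\mathcal{G})$ of a small category $\mathcal{C}$ and a set $\mathcal{G}$ of graphs with $\bullet\in\mathcal{G}$ such that (W1) every $\mathcal{G}$-structured decomposition in $\mathcal{C}$ has a colimit in $\mathcal{C}$. Spined sd-category: a triple $(\mathcal{C},\mathcal{G},\Omega)$, where $(\mathcal{C},\mathcal{G})$ is an sd-category and $\Omega=\bigcup_{n\ge0}\Omega_n$ is a full subcategory closed under isomorphism, filtered by full subcategories $\Omega_0\subseteq\Omega_1\subseteq\cdots$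 closed under isomorphism, such that (W2a) every object $X$ admits a monomorphism $X\hookrightarrow W$ with $W\in\Omega$; (W2b) for $n\ge1$ and $W\in\Omega_n\setminus\Omega_{n-1}$ there is no monomorphism from $W$ into any object of $\Omega_{n-1}$. Width category: a spined sd-category that is monic-stable, i.e. pullbacks of monomorphisms along arbitrary morphisms exist in $\mathcal{C}$ and (W3) for every $\mathcal{G}$-structured decomposition $d$ of an object $Y$ with colimit cocone $(d(i)\to Y)_i$ and every monomorphism $f:X\to Y$, the pullback of this cocone along $f$ (with objects $f^*(d)(i)=X\times_Y d(i)$ and maps to $X$ the projections) exists and is a colimit cocone with apex $X$. Size and width: $s(X)$ is the smallest $n$ such that there is a monomorphism $X\hookrightarrow W$ with $W\in\Omega_n$. The width of $d:\int G\to\mathcal{C}$ is $w(d)=\max_{x\in V(G)}s(d(x))-1$ (the maximum over the empty set being read as $0$). The $\Gamma$-width of $X$ is $\mathbf{w}_\Gamma(X)=\min_d w(d)$ over all $\mathcal{G}$-structured decompositions $d$ of $X$. *)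

theory Defs
  imports Main
begin

section \<open>Small categories\<close>

text \<open>\<open>comp C g f\<close> is the composite of \<open>f\<close> followed by \<open>g\<close>. Only the values on \<open>Ob C\<close>,
  \<open>Mor C\<close> and on composable pairs matter.\<close>

record ('o, 'm) cat =
  Ob :: "'o set"
  Mor :: "'m set"
  Dom :: "'m \<Rightarrow> 'o"
  Cod :: "'m \<Rightarrow> 'o"
  Id :: "'o \<Rightarrow> 'm"
  comp :: "'m \<Rightarrow> 'm \<Rightarrow> 'm"  (infixr "\<cdot>\<index>" 70)

definition Hom :: "('o, 'm) cat \<Rightarrow> 'o \<Rightarrow> 'o \<Rightarrow> 'm set" where
  "Hom C X Y = {f \<in> Mor C. Dom C f = X \<and> Cod C f = Y}"

locale category =
  fixes C :: "('o, 'm) cat" (structure)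
  assumes Dom_Ob: "f \<in> Mor C \<Longrightarrow> Dom C f \<in> Ob C"
    and Cod_Ob: "f \<in> Mor C \<Longrightarrow> Cod C f \<in> Ob C"
    and Id_Hom: "X \<in> Ob C \<Longrightarrow> Id C X \<in> Hom C X X"
    and comp_Hom: "\<lbrakk>f \<in> Hom C X Y; g \<in> Hom C Y Z\<rbrakk> \<Longrightarrow> g \<cdot> f \<in> Hom C X Z"
    and comp_Id: "f \<in> Hom C X Y \<Longrightarrow> f \<cdot> Id C X = f"
    and Id_comp: "f \<in> Hom C X Y \<Longrightarrow> Id C Y \<cdot> f = f"
    and comp_assoc: "\<lbrakk>f \<in> Hom C X Y; g \<in> Hom C Y Z; h \<in> Hom C Z W\<rbrakk>
      \<Longrightarrow> (h \<cdot> g) \<cdot> f = h \<cdot> (g \<cdot> f)"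

definition monic :: "('o, 'm) cat \<Rightarrow> 'm \<Rightarrow> bool" where
  "monic C f \<longleftrightarrow> f \<in> Mor C \<and>
    (\<forall>Z \<in> Ob C. \<forall>g \<in> Hom C Z (Dom C f). \<forall>h \<in> Hom C Z (Dom C f).
      f \<cdot>\<^bsub>C\<^esub> g = f \<cdot>\<^bsub>C\<^esub> h \<longrightarrow> g = h)"

definition embeds :: "('o, 'm) cat \<Rightarrow> 'o \<Rightarrow> 'o \<Rightarrow> bool" where
  "embeds C X Y \<longleftrightarrow> (\<exists>f \<in> Hom C X Y. monic C f)"

definition isomorphic :: "('o, 'm) cat \<Rightarrow> 'o \<Rightarrow> 'o \<Rightarrow> bool" where
  "isomorphic C X Y \<longleftrightarrow> X \<in> Ob C \<and> Y \<in> Ob C \<and>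
    (\<exists>f \<in> Hom C X Y. \<exists>g \<in> Hom C Y X. g \<cdot>\<^bsub>C\<^esub> f = Id C X \<and> f \<cdot>\<^bsub>C\<^esub> g = Id C Y)"

text \<open>The square with \<open>p : P \<rightarrow> A\<close>, \<open>q : P \<rightarrow> B\<close>, \<open>f : A \<rightarrow> Z\<close>, \<open>g : B \<rightarrow> Z\<close>.\<close>

definition is_pullback :: "('o, 'm) cat \<Rightarrow> 'm \<Rightarrow> 'm \<Rightarrow> 'o \<Rightarrow> 'm \<Rightarrow> 'm \<Rightarrow> bool" where
  "is_pullback C f g P p q \<longleftrightarrow>
    f \<in> Mor C \<and> g \<in> Mor C \<and> Cod C f = Cod C g \<and>
    P \<in> Ob C \<and> p \<in> Hom C P (Dom C f) \<and> q \<in> Hom C P (Dom C g) \<and>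
    f \<cdot>\<^bsub>C\<^esub> p = g \<cdot>\<^bsub>C\<^esub> q \<and>
    (\<forall>T \<in> Ob C. \<forall>a \<in> Hom C T (Dom C f). \<forall>b \<in> Hom C T (Dom C g).
      f \<cdot>\<^bsub>C\<^esub> a = g \<cdot>\<^bsub>C\<^esub> b \<longrightarrow>
      (\<exists>!h. h \<in> Hom C T P \<and> p \<cdot>\<^bsub>C\<^esub> h = a \<and> q \<cdot>\<^bsub>C\<^esub> h = b))"

record ('o1, 'm1, 'o2, 'm2) ftor =
  on_ob :: "'o1 \<Rightarrow> 'o2"
  on_mor :: "'m1 \<Rightarrow> 'm2"

definition is_functor ::
  "('o1, 'm1) cat \<Rightarrow> ('o2, 'm2) cat \<Rightarrow> ('o1, 'm1, 'o2, 'm2) ftor \<Rightarrow> bool" where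
  "is_functor J C d \<longleftrightarrow>
    (\<forall>i \<in> Ob J. on_ob d i \<in> Ob C \<and> on_mor d (Id J i) = Id C (on_ob d i)) \<and>
    (\<forall>u \<in> Mor J. on_mor d u \<in> Hom C (on_ob d (Dom J u)) (on_ob d (Cod J u))) \<and>
    (\<forall>u \<in> Mor J. \<forall>v \<in> Mor J. Cod J u = Dom J v \<longrightarrow>
      on_mor d (v \<cdot>\<^bsub>J\<^esub> u) = on_mor d v \<cdot>\<^bsub>C\<^esub> on_mor d u)"

definition is_nat_trans ::
  "('o1, 'm1) cat \<Rightarrow> ('o2, 'm2) cat \<Rightarrow> ('o1, 'm1, 'o2, 'm2) ftor \<Rightarrow>
    ('o1, 'm1, 'o2, 'm2) ftor \<Rightarrow> ('o1 \<Rightarrow> 'm2) \<Rightarrow> bool" where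
  "is_nat_trans J C d d' q \<longleftrightarrow>
    (\<forall>i \<in> Ob J. q i \<in> Hom C (on_ob d i) (on_ob d' i)) \<and>
    (\<forall>u \<in> Mor J. on_mor d' u \<cdot>\<^bsub>C\<^esub> q (Dom J u) = q (Cod J u) \<cdot>\<^bsub>C\<^esub> on_mor d u)"

definition is_cocone ::
  "('o1, 'm1) cat \<Rightarrow> ('o2, 'm2) cat \<Rightarrow> ('o1, 'm1, 'o2, 'm2) ftor \<Rightarrow>
    'o2 \<Rightarrow> ('o1 \<Rightarrow> 'm2) \<Rightarrow> bool" where
  "is_cocone J C d Z c \<longleftrightarrow> Z \<in> Ob C \<and>
    (\<forall>i \<in> Ob J. c i \<in> Hom C (on_ob d i) Z) \<and>
    (\<forall>u \<in> Mor J. c (Cod J u) \<cdot>\<^bsub>C\<^esub> on_mor d u = c (Dom J u))"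

definition is_colimit ::
  "('o1, 'm1) cat \<Rightarrow> ('o2, 'm2) cat \<Rightarrow> ('o1, 'm1, 'o2, 'm2) ftor \<Rightarrow>
    'o2 \<Rightarrow> ('o1 \<Rightarrow> 'm2) \<Rightarrow> bool" where
  "is_colimit J C d Z c \<longleftrightarrow> is_cocone J C d Z c \<and>
    (\<forall>Z' c'. is_cocone J C d Z' c' \<longrightarrow>
      (\<exists>!h. h \<in> Hom C Z Z' \<and> (\<forall>i \<in> Ob J. h \<cdot>\<^bsub>C\<^esub> c i = c' i)))"

text \<open>The pullback along \<open>f : X \<rightarrow> Y\<close> of a cocone \<open>c\<close> with apex \<open>Y\<close> under \<open>d\<close>: the functor \<open>d'\<close>
  has objects \<open>d' i = X \<times>\<^sub>Y d i\<close> with projections \<open>p i\<close> to \<open>X\<close> and \<open>q i\<close> to \<open>d i\<close>. Naturality of \<open>q\<close>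
  and the cocone condition on \<open>p\<close> say that \<open>d'\<close> sends a morphism of the index category to the
  induced map between the pullbacks.\<close>

definition is_cocone_pullback ::
  "('o1, 'm1) cat \<Rightarrow> ('o2, 'm2) cat \<Rightarrow> ('o1, 'm1, 'o2, 'm2) ftor \<Rightarrow> ('o1 \<Rightarrow> 'm2) \<Rightarrow> 'm2 \<Rightarrow>
    ('o1, 'm1, 'o2, 'm2) ftor \<Rightarrow> ('o1 \<Rightarrow> 'm2) \<Rightarrow> ('o1 \<Rightarrow> 'm2) \<Rightarrow> bool" where
  "is_cocone_pullback J C d c f d' p q \<longleftrightarrow>
    is_functor J C d' \<and> is_cocone J C d' (Dom C f) p \<and> is_nat_trans J C d' d q \<and>
    (\<forall>i \<in> Ob J. is_pullback C f (c i) (on_ob d' i) (p i) (q i))"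


section \<open>Graphs and their index categories\<close>

text \<open>One type covers simple graphs and multigraphs: every edge \<open>e\<close> has a two-element set
  \<open>legs G e\<close> of legs, the leg \<open>l\<close> being attached to the vertex \<open>tip G e l\<close>. Both legs of a loop have
  the same tip, but they remain distinct. A simple graph is obtained by letting the legs of the
  unordered edge \<open>{x, y}\<close> be its end vertices \<open>x\<close> and \<open>y\<close> themselves (\<open>simple_graph\<close> below).\<close>

record ('v, 'e, 'l) graph =
  verts :: "'v set"
  edges :: "'e set"
  legs :: "'e \<Rightarrow> 'l set"
  tip :: "'e \<Rightarrow> 'l \<Rightarrow> 'v"

definition is_graph :: "('v, 'e, 'l) graph \<Rightarrow> bool" where
  "is_graph G \<longleftrightarrow> finite (verts G) \<and>
    (\<forall>e \<in> edges G. card (legs G e) = 2 \<and> (\<forall>l \<in> legs G e. tip G e l \<in> verts G))"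

definition simple_graph :: "'v set \<Rightarrow> ('v \<times> 'v) set \<Rightarrow> ('v, 'v set, 'v) graph" where
  "simple_graph V E =
    \<lparr>verts = V, edges = {{x, y} |x y. (x, y) \<in> E}, legs = (\<lambda>e. e), tip = (\<lambda>e x. x)\<rparr>"

lemma is_graph_simple_graph:
  assumes "finite V" "E \<subseteq> V \<times> V" "sym E" "irrefl E"
  shows "is_graph (simple_graph V E)"
  using assms unfolding is_graph_def simple_graph_def irrefl_def
  by (fastforce simp: card_insert_if)

definition is_bullet :: "('v, 'e, 'l) graph \<Rightarrow> bool" where
  "is_bullet G \<longleftrightarrow> (\<exists>v. verts G = {v}) \<and> edges G = {}"

datatype ('v, 'e) gob = Vertex 'v | Edge 'e

datatype ('v, 'e, 'l) gmor = Ident "('v, 'e) gob" | Leg 'e 'l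

text \<open>In \<open>int_cat G\<close> nothing but identities starts at a vertex, so a composable pair always
  contains an identity.\<close>

definition int_cat :: "('v, 'e, 'l) graph \<Rightarrow> (('v, 'e) gob, ('v, 'e, 'l) gmor) cat" where
  "int_cat G =
    \<lparr>Ob = Vertex ` verts G \<union> Edge ` edges G,
     Mor = Ident ` (Vertex ` verts G \<union> Edge ` edges G) \<union> {Leg e l |e l. e \<in> edges G \<and> l \<in> legs G e},
     Dom = (\<lambda>u. case u of Ident x \<Rightarrow> x | Leg e l \<Rightarrow> Edge e),
     Cod = (\<lambda>u. case u of Ident x \<Rightarrow> x | Leg e l \<Rightarrow> Vertex (tip G e l)),
     Id = Ident,
     comp = (\<lambda>v u. case u of Ident x \<Rightarrow> v | Leg e l \<Rightarrow> u)\<rparr>"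

lemma category_int_cat:
  assumes "is_graph G"
  shows "category (int_cat G)"
  using assms
  by unfold_locales
    (auto simp: is_graph_def int_cat_def Hom_def split: gmor.splits)


section \<open>Structured decompositions\<close>

type_synonym ('v, 'e, 'l, 'o, 'm) decomp = "(('v, 'e) gob, ('v, 'e, 'l) gmor, 'o, 'm) ftor"

definition is_sd ::
  "('o, 'm) cat \<Rightarrow> ('v, 'e, 'l) graph \<Rightarrow> ('v, 'e, 'l, 'o, 'm) decomp \<Rightarrow> bool" where
  "is_sd C G d \<longleftrightarrow> is_functor (int_cat G) C d \<and> (\<forall>u \<in> Mor (int_cat G). monic C (on_mor d u))"

definition is_sd_of ::
  "('o, 'm) cat \<Rightarrow> ('v, 'e, 'l) graph \<Rightarrow> ('v, 'e, 'l, 'o, 'm) decomp \<Rightarrow> 'o \<Rightarrow> bool" where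
  "is_sd_of C G d X \<longleftrightarrow> is_sd C G d \<and>
    (\<exists>Z c. is_colimit (int_cat G) C d Z c \<and> isomorphic C X Z)"

locale sd_category = category C
  for C :: "('o, 'm) cat" (structure) +
  fixes \<G> :: "('v, 'e, 'l) graph set"
  assumes graphs: "G \<in> \<G> \<Longrightarrow> is_graph G"
    and bullet: "\<exists>G \<in> \<G>. is_bullet G"
    and W1: "\<lbrakk>G \<in> \<G>; is_sd C G d\<rbrakk> \<Longrightarrow> \<exists>Z c. is_colimit (int_cat G) C d Z c"

text \<open>A full subcategory is given by its set of objects; \<open>\<Omega> n\<close> is the \<open>n\<close>-th filtration step, and
  the union of all steps is the full subcategory of spine objects.\<close>

locale spined_sd_category = sd_category C \<G>
  for C :: "('o, 'm) cat" (structure) and \<G> :: "('v, 'e, 'l) graph set" +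
  fixes \<Omega> :: "nat \<Rightarrow> 'o set"
  assumes \<Omega>_Ob: "\<Omega> n \<subseteq> Ob C"
    and \<Omega>_mono: "\<Omega> n \<subseteq> \<Omega> (Suc n)"
    and \<Omega>_iso: "\<lbrakk>W \<in> \<Omega> n; isomorphic C W W'\<rbrakk> \<Longrightarrow> W' \<in> \<Omega> n"
    and W2a: "X \<in> Ob C \<Longrightarrow> \<exists>W \<in> (\<Union>n. \<Omega> n). embeds C X W"
    and W2b: "\<lbrakk>n \<ge> 1; W \<in> \<Omega> n - \<Omega> (n - 1); W' \<in> \<Omega> (n - 1)\<rbrakk> \<Longrightarrow> \<not> embeds C W W'"

locale width_category = spined_sd_category C \<G> \<Omega>
  for C :: "('o, 'm) cat" (structure) and \<G> :: "('v, 'e, 'l) graph set"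
    and \<Omega> :: "nat \<Rightarrow> 'o set" +
  assumes monic_pullbacks: "\<lbrakk>monic C f; g \<in> Mor C; Cod C f = Cod C g\<rbrakk>
      \<Longrightarrow> \<exists>P p q. is_pullback C f g P p q"
    and W3_exists: "\<lbrakk>G \<in> \<G>; is_sd C G d; is_colimit (int_cat G) C d Y c; f \<in> Hom C X Y; monic C f\<rbrakk>
      \<Longrightarrow> \<exists>d' p q. is_cocone_pullback (int_cat G) C d c f d' p q"
    and W3_colimit: "\<lbrakk>G \<in> \<G>; is_sd C G d; is_colimit (int_cat G) C d Y c; f \<in> Hom C X Y; monic C f;
        is_cocone_pullback (int_cat G) C d c f d' p q\<rbrakk>
      \<Longrightarrow> is_colimit (int_cat G) C d' X p"


section \<open>Size and width\<close>

definition obj_size :: "('o, 'm) cat \<Rightarrow> (nat \<Rightarrow> 'o set) \<Rightarrow> 'o \<Rightarrow> nat" where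
  "obj_size C \<Omega> X = (LEAST n. \<exists>W \<in> \<Omega> n. embeds C X W)"

text \<open>Widths are integers: the width is \<open>- 1\<close> if all bags have size \<open>0\<close>, and also if there are no
  bags at all, the empty maximum being \<open>0\<close>.\<close>

definition sd_width ::
  "('o, 'm) cat \<Rightarrow> (nat \<Rightarrow> 'o set) \<Rightarrow> ('v, 'e, 'l) graph \<Rightarrow> ('v, 'e, 'l, 'o, 'm) decomp \<Rightarrow> int" where
  "sd_width C \<Omega> G d =
    int (if verts G = {} then 0 else Max ((\<lambda>x. obj_size C \<Omega> (on_ob d (Vertex x))) ` verts G)) - 1"

definition Gamma_width ::
  "('o, 'm) cat \<Rightarrow> ('v, 'e, 'l) graph set \<Rightarrow> (nat \<Rightarrow> 'o set) \<Rightarrow> 'o \<Rightarrow> int" where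
  "Gamma_width C \<G> \<Omega> X =
    (LEAST w. \<exists>G \<in> \<G>. \<exists>d. is_sd_of C G d X \<and> w = sd_width C \<Omega> G d)"

end

theory Submission
  imports Defs
begin

text \<open>Pulling an optimal decomposition of \<open>Y\<close> back along \<open>f\<close> gives a decomposition of \<open>X\<close> of the
  same shape. Its projections to the old bags are pullbacks of the monomorphism \<open>f\<close>, hence monic,
  so no bag has grown in size; monicity of the projections also forces the structure maps of the new
  diagram to be monic.\<close>

text \<open>\<open>int\<close> is not well-ordered, so \<open>LEAST\<close> over it needs a lower
  bound: shifting by \<open>b\<close> reduces the question to a minimum of natural numbers. The
  integer form is forced by the width \<open>- 1\<close>.\<close>

lemma int_bounded_below_Least:
  fixes P :: "int \<Rightarrow> bool"
  assumes "P w" and bound: "\<And>w. P w \<Longrightarrow> b \<le> w"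
  shows "P (LEAST w. P w)" and "(LEAST w. P w) \<le> w"
proof -
  define m where "m = b + int (LEAST n. P (b + int n))"
  \<comment> \<open>Truncation by \<open>nat\<close> loses nothing here, because every
    \<open>v\<close> satisfying \<open>P\<close> lies above \<open>b\<close>.\<close>
  have nat_rep: "b + int (nat (v - b)) = v" if "P v" for v
    using bound[OF that] by simp
  have "P m"
    unfolding m_def by (rule LeastI[where k = "nat (w - b)"]) (use nat_rep[OF assms(1)] assms(1) in simp)
  moreover have le: "m \<le> v" if "P v" for v
  proof -
    have "(LEAST n. P (b + int n)) \<le> nat (v - b)"
      by (rule Least_le) (use nat_rep[OF that] that in simp)
    with nat_rep[OF that] show ?thesis
      unfolding m_def by linarith
  qed
  ultimately have "(LEAST w. P w) = m"
    by (rule Least_equality)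
  with \<open>P m\<close> le[OF assms(1)] show "P (LEAST w. P w)" and "(LEAST w. P w) \<le> w"
    by simp_all
qed

lemma HomD:
  assumes "f \<in> Hom C X Y"
  shows "f \<in> Mor C" "Dom C f = X" "Cod C f = Y"
  using assms by (auto simp: Hom_def)

lemma monicD:
  assumes "monic C f" "f \<in> Hom C X Y" "Z \<in> Ob C" "g \<in> Hom C Z X" "h \<in> Hom C Z X"
    and "f \<cdot>\<^bsub>C\<^esub> g = f \<cdot>\<^bsub>C\<^esub> h"
  shows "g = h"
  using assms unfolding monic_def by (auto dest: HomD)

lemma monicI:
  assumes "f \<in> Hom C X Y"
    and "\<And>Z g h. \<lbrakk>Z \<in> Ob C; g \<in> Hom C Z X; h \<in> Hom C Z X; f \<cdot>\<^bsub>C\<^esub> g = f \<cdot>\<^bsub>C\<^esub> h\<rbrakk> \<Longrightarrow> g = h"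
  shows "monic C f"
  using assms unfolding monic_def by (auto dest: HomD)

context category
begin

lemma Hom_Ob:
  assumes "f \<in> Hom C X Y"
  shows "X \<in> Ob C" "Y \<in> Ob C"
  using assms Dom_Ob Cod_Ob by (auto simp: Hom_def)

lemma monic_comp:
  assumes f: "f \<in> Hom C X Y" "monic C f" and g: "g \<in> Hom C Y Z" "monic C g"
  shows "monic C (g \<cdot> f)"
proof (rule monicI[OF comp_Hom[OF f(1) g(1)]])
  fix T a b
  assume T: "T \<in> Ob C" and a: "a \<in> Hom C T X" and b: "b \<in> Hom C T X"
    and "(g \<cdot> f) \<cdot> a = (g \<cdot> f) \<cdot> b"
  then have "g \<cdot> (f \<cdot> a) = g \<cdot> (f \<cdot> b)"
    using f g by (simp add: comp_assoc)
  then have "f \<cdot> a = f \<cdot> b"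
    using monicD[OF g(2,1) T] comp_Hom f(1) a b by blast
  then show "a = b"
    using monicD[OF f(2,1) T a b] by blast
qed

text \<open>Used twice: with \<open>g \<cdot> f\<close> an identity it makes isomorphisms monic, and
  it yields monic structure maps of a pulled-back diagram.\<close>

lemma monic_cancel:
  assumes f: "f \<in> Hom C X Y" and g: "g \<in> Hom C Y Z" and gf: "monic C (g \<cdot> f)"
  shows "monic C f"
proof (rule monicI[OF f])
  fix T a b
  assume T: "T \<in> Ob C" and a: "a \<in> Hom C T X" and b: "b \<in> Hom C T X" and "f \<cdot> a = f \<cdot> b"
  then have "(g \<cdot> f) \<cdot> a = (g \<cdot> f) \<cdot> b"
    using f g by (simp add: comp_assoc)
  then show "a = b"
    using monicD[OF gf comp_Hom[OF f g] T a b] by blast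
qed

lemma monic_Id:
  assumes "X \<in> Ob C"
  shows "monic C (Id C X)"
  using assms by (intro monicI[OF Id_Hom]) (auto simp: Id_comp)

lemma isomorphic_refl:
  assumes "X \<in> Ob C"
  shows "isomorphic C X X"
  unfolding isomorphic_def using assms Id_Hom comp_Id by blast

lemma isomorphic_embeds:
  assumes "isomorphic C X Y"
  shows "embeds C X Y"
proof -
  from assms obtain f g where "f \<in> Hom C X Y" "g \<in> Hom C Y X" "g \<cdot> f = Id C X" "X \<in> Ob C"
    unfolding isomorphic_def by blast
  then show ?thesis
    unfolding embeds_def using monic_cancel monic_Id by metis
qed

lemma embeds_trans:
  assumes "embeds C X Y" "embeds C Y Z"
  shows "embeds C X Z"
  using assms unfolding embeds_def by (meson comp_Hom monic_comp)

text \<open>If two maps into \<open>P\<close> agree after \<open>q\<close>, the square makes them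
  agree after \<open>f \<cdot> p\<close>, hence after \<open>p\<close> since \<open>f\<close> is
  monic; a map into a pullback is determined by its two components.\<close>

lemma monic_pullback:
  assumes pb: "is_pullback C f g P p q" and f: "monic C f"
  shows "monic C q"
proof -
  have f_Hom: "f \<in> Hom C (Dom C f) (Cod C f)" and g_Hom: "g \<in> Hom C (Dom C g) (Cod C f)"
    and p: "p \<in> Hom C P (Dom C f)" and q: "q \<in> Hom C P (Dom C g)"
    and square: "f \<cdot> p = g \<cdot> q"
    using pb by (auto simp: is_pullback_def Hom_def)
  show ?thesis
  proof (rule monicI[OF q])
    fix T a b
    assume T: "T \<in> Ob C" and a: "a \<in> Hom C T P" and b: "b \<in> Hom C T P" and eq: "q \<cdot> a = q \<cdot> b"
    have outer: "f \<cdot> (p \<cdot> x) = g \<cdot> (q \<cdot> x)" if "x \<in> Hom C T P" for x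
      using comp_assoc[OF that p f_Hom] comp_assoc[OF that q g_Hom] square by simp
    have "f \<cdot> (p \<cdot> a) = f \<cdot> (p \<cdot> b)"
      using outer[OF a] outer[OF b] eq by simp
    then have "p \<cdot> a = p \<cdot> b"
      using monicD[OF f f_Hom T comp_Hom[OF a p] comp_Hom[OF b p]] by blast
    \<comment> \<open>Both \<open>a\<close> and \<open>b\<close> mediate for the cone with
      components \<open>p \<cdot> b\<close> and \<open>q \<cdot> b\<close>.\<close>
    moreover have "\<exists>!h. h \<in> Hom C T P \<and> p \<cdot> h = p \<cdot> b \<and> q \<cdot> h = q \<cdot> b"
      using pb T comp_Hom[OF b p] comp_Hom[OF b q] outer[OF b] unfolding is_pullback_def by blast
    ultimately show "a = b"
      using a b eq by blast
  qed
qed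

lemma is_sd_constant:
  assumes "X \<in> Ob C"
  shows "is_sd C G \<lparr>on_ob = \<lambda>_. X, on_mor = \<lambda>_. Id C X\<rparr>"
  using assms Id_Hom monic_Id comp_Id[OF Id_Hom] by (auto simp: is_sd_def is_functor_def)

text \<open>Guarantees that every object has some decomposition, so that the minimum defining its
  width ranges over a nonempty set.\<close>

lemma bullet_is_sd_of:
  assumes X: "X \<in> Ob C" and G: "is_bullet G"
  shows "is_sd_of C G \<lparr>on_ob = \<lambda>_. X, on_mor = \<lambda>_. Id C X\<rparr> X" (is "is_sd_of C G ?d X")
proof -
  obtain v where Ob: "Ob (int_cat G) = {Vertex v}" and Mor: "Mor (int_cat G) = {Ident (Vertex v)}"
    using G by (auto simp: is_bullet_def int_cat_def)
  have "is_colimit (int_cat G) C ?d X (\<lambda>_. Id C X)"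
    unfolding is_colimit_def
  proof (intro conjI allI impI)
    show "is_cocone (int_cat G) C ?d X (\<lambda>_. Id C X)"
      using X Id_Hom comp_Id[OF Id_Hom] by (simp add: is_cocone_def)
  next
    fix Z c
    assume "is_cocone (int_cat G) C ?d Z c"
    then have "c (Vertex v) \<in> Hom C X Z"
      by (simp add: is_cocone_def Ob)
    then show "\<exists>!h. h \<in> Hom C X Z \<and> (\<forall>i\<in>Ob (int_cat G). h \<cdot> Id C X = c i)"
      \<comment> \<open>The mediating map can only be the single leg of the cocone, as the colimit
        leg is an identity.\<close>
      unfolding Ob using comp_Id by (intro ex1I[of _ "c (Vertex v)"]) auto
  qed
  with is_sd_constant isomorphic_refl X show ?thesis
    unfolding is_sd_of_def by blast
qed

end

lemma (in spined_sd_category) obj_size_mono: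
  assumes XY: "embeds C X Y"
  shows "obj_size C \<Omega> X \<le> obj_size C \<Omega> Y"
proof -
  have "Y \<in> Ob C"
    using XY Hom_Ob by (auto simp: embeds_def)
  \<comment> \<open>By W2a the \<open>LEAST\<close> defining the size of \<open>Y\<close> is
    attained; a witness for \<open>Y\<close> then serves \<open>X\<close> by composition.\<close>
  then have "\<exists>n. \<exists>W \<in> \<Omega> n. embeds C Y W"
    using W2a by blast
  then have "\<exists>W \<in> \<Omega> (obj_size C \<Omega> Y). embeds C Y W"
    unfolding obj_size_def by (rule LeastI_ex)
  then have "\<exists>W \<in> \<Omega> (obj_size C \<Omega> Y). embeds C X W"
    using embeds_trans[OF XY] by blast
  then show ?thesis
    unfolding obj_size_def[of _ _ X] by (rule Least_le)
qed

lemma sd_width_mono: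
  assumes "finite (verts G)"
    and "\<And>x. x \<in> verts G \<Longrightarrow>
      obj_size C \<Omega> (on_ob d' (Vertex x)) \<le> obj_size C \<Omega> (on_ob d (Vertex x))"
  shows "sd_width C \<Omega> G d' \<le> sd_width C \<Omega> G d"
\<comment> \<open>With no vertices both widths are \<open>- 1\<close> by the convention on the empty
  maximum; the closing \<open>simp\<close> settles that case.\<close>
proof (cases "verts G = {}")
  case False
  then have "Max ((\<lambda>x. obj_size C \<Omega> (on_ob d' (Vertex x))) ` verts G)
      \<le> Max ((\<lambda>x. obj_size C \<Omega> (on_ob d (Vertex x))) ` verts G)"
    using assms by (intro Max.boundedI) (auto intro: order_trans[OF _ Max_ge])
  with False show ?thesis
    by (simp add: sd_width_def)
qed (simp add: sd_width_def)

lemma sd_width_ge: "- 1 \<le> sd_width C \<Omega> G d"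
  by (simp add: sd_width_def)

lemma Gamma_width_le:
  assumes "G \<in> \<G>" "is_sd_of C G d X"
  shows "Gamma_width C \<G> \<Omega> X \<le> sd_width C \<Omega> G d"
  unfolding Gamma_width_def
  by (rule int_bounded_below_Least(2)[where b = "- 1"]) (use assms sd_width_ge in blast)+

lemma (in spined_sd_category) Gamma_width_attained:
  assumes "X \<in> Ob C"
  obtains G d where "G \<in> \<G>" "is_sd_of C G d X" "Gamma_width C \<G> \<Omega> X = sd_width C \<Omega> G d"
proof -
  let ?P = "\<lambda>w. \<exists>G \<in> \<G>. \<exists>d. is_sd_of C G d X \<and> w = sd_width C \<Omega> G d"
  obtain w where "?P w"
    using bullet bullet_is_sd_of[OF assms] by blast
  then have "?P (Gamma_width C \<G> \<Omega> X)"
    unfolding Gamma_width_def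
    by (rule int_bounded_below_Least(1)[where b = "- 1"]) (use sd_width_ge in blast)
  with that show thesis
    by blast
qed

text \<open>Naturality of \<open>q\<close> equates \<open>on_mor d u \<cdot> q i\<close> with
  \<open>q j \<cdot> on_mor d' u\<close> for \<open>u\<close> from \<open>i\<close> to
  \<open>j\<close>. The first is a composite of monomorphisms, so the right factor of the second is
  monic.\<close>

lemma (in category) is_sd_cocone_pullback:
  assumes sd: "is_sd C G d" and G: "is_graph G" and f: "monic C f"
    and pb: "is_cocone_pullback (int_cat G) C d c f d' p q"
  shows "is_sd C G d'"
  unfolding is_sd_def
proof (intro conjI ballI)
  show ftor: "is_functor (int_cat G) C d'"
    using pb by (simp add: is_cocone_pullback_def)
  fix u
  assume u: "u \<in> Mor (int_cat G)"
  interpret J: category "int_cat G"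
    using G by (rule category_int_cat)
  let ?i = "Dom (int_cat G) u" and ?j = "Cod (int_cat G) u"
  have i: "?i \<in> Ob (int_cat G)" and j: "?j \<in> Ob (int_cat G)"
    using u J.Dom_Ob J.Cod_Ob by auto
  have q: "q k \<in> Hom C (on_ob d' k) (on_ob d k)" "monic C (q k)" if "k \<in> Ob (int_cat G)" for k
    using pb that monic_pullback[OF _ f] by (auto simp: is_cocone_pullback_def is_nat_trans_def)
  have du: "on_mor d u \<in> Hom C (on_ob d ?i) (on_ob d ?j)" "monic C (on_mor d u)"
    using sd u by (auto simp: is_sd_def is_functor_def)
  have d'u: "on_mor d' u \<in> Hom C (on_ob d' ?i) (on_ob d' ?j)"
    using ftor u by (auto simp: is_functor_def)
  have "on_mor d u \<cdot> q ?i = q ?j \<cdot> on_mor d' u"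
    using pb u by (simp add: is_cocone_pullback_def is_nat_trans_def)
  moreover have "monic C (on_mor d u \<cdot> q ?i)"
    using q[OF i] du by (rule monic_comp)
  ultimately show "monic C (on_mor d' u)"
    using monic_cancel[OF d'u q(1)[OF j]] by simp
qed

theorem proposition2p5p18:
  fixes C :: "('o, 'm) cat"
    and \<G> :: "('v, 'e, 'l) graph set"
    and \<Omega> :: "nat \<Rightarrow> 'o set"
    and X Y :: 'o and f :: 'm
  assumes "width_category C \<G> \<Omega>"
    and "f \<in> Hom C X Y"
    and "monic C f"
  shows "Gamma_width C \<G> \<Omega> X \<le> Gamma_width C \<G> \<Omega> Y"
proof -
  interpret width_category C \<G> \<Omega>
    by (rule assms(1))
  have X: "X \<in> Ob C" and Y: "Y \<in> Ob C"
    using Hom_Ob[OF assms(2)] by auto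
  obtain G d where G: "G \<in> \<G>" and d: "is_sd_of C G d Y"
    and width: "Gamma_width C \<G> \<Omega> Y = sd_width C \<Omega> G d"
    using Gamma_width_attained[OF Y] .
  \<comment> \<open>The colimit apex \<open>Z\<close> is only isomorphic to \<open>Y\<close>, while
    W3 pulls back along a monomorphism into the apex itself. So \<open>f\<close> is replaced by a
    monomorphism \<open>g\<close> from \<open>X\<close> to \<open>Z\<close>.\<close>
  from d obtain Z c where sd: "is_sd C G d" and colim: "is_colimit (int_cat G) C d Z c"
    and "isomorphic C Y Z"
    unfolding is_sd_of_def by blast
  then have "embeds C X Z"
    using assms isomorphic_embeds embeds_trans unfolding embeds_def by blast
  then obtain g where g: "g \<in> Hom C X Z" "monic C g"
    unfolding embeds_def by blast
  obtain d' p q where pb: "is_cocone_pullback (int_cat G) C d c g d' p q"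
    using W3_exists[OF G sd colim g] by blast
  \<comment> \<open>The pulled-back cocone has apex \<open>X\<close> itself, so the identity serves
    as the required isomorphism.\<close>
  have "is_sd_of C G d' X"
    unfolding is_sd_of_def
    using is_sd_cocone_pullback[OF sd graphs[OF G] g(2) pb] W3_colimit[OF G sd colim g pb]
      isomorphic_refl[OF X] by blast
  then have "Gamma_width C \<G> \<Omega> X \<le> sd_width C \<Omega> G d'"
    using G by (intro Gamma_width_le)
  also have "\<dots> \<le> sd_width C \<Omega> G d"
  proof (rule sd_width_mono)
    show "finite (verts G)"
      using graphs[OF G] by (simp add: is_graph_def)
  next
    fix x
    assume "x \<in> verts G"
    then have "Vertex x \<in> Ob (int_cat G)"
      by (simp add: int_cat_def)
    \<comment> \<open>The projection to the old bag lies opposite \<open>g\<close> in its pullback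
      square and so inherits monicity.\<close>
    then have "q (Vertex x) \<in> Hom C (on_ob d' (Vertex x)) (on_ob d (Vertex x))"
      and "monic C (q (Vertex x))"
      using pb monic_pullback[OF _ g(2)] by (auto simp: is_cocone_pullback_def is_nat_trans_def)
    then have "embeds C (on_ob d' (Vertex x)) (on_ob d (Vertex x))"
      unfolding embeds_def by blast
    then show "obj_size C \<Omega> (on_ob d' (Vertex x)) \<le> obj_size C \<Omega> (on_ob d (Vertex x))"
      by (rule obj_size_mono)
  qed
  finally show ?thesis
    using width by simp
qed

end
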